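(* Let $n\ge 1$ and $h\ge 1$ be integers. Every online algorithm for the $h$-AO-SP with $n$ online candidates has competitive-ratio at most $\frac{h}{n+h-1}$; that is, for every online algorithm and every $\varepsilon>0$ there is an instance (a set $C$ of $n+h$ candidates) and an adversarial ordering strategy for which $\mathbb{E}[\mathrm{ALG}] \le \left(\frac{h}{n+h-1}+\varepsilon\right)\mathbb{E}[\mathrm{OPT}]$.
   Context: The adversarial-order secretary problem with a sample of size $h$ ($h$-AO-SP), for integers $n\ge 1$, $h\ge 0$: an adversary picks a set $C$ of $n+h$ candidates, each with a value in $\mathbb{R}_{\ge 0}$ (candidates are totally ordered by value, ties broken by a fixed consistent tie-breaker). A subset $H\subseteq C$ of cardinality $h$ (the history set) is drawn uniformly at random and given, together with $n$, to the online player upfront; $O = C\setminus H$ is the online set. The adversary then chooses an order $c_1,\dots,c_n$ of $O$ (which may depend on $H$), and the candidates are revealed one by one; after each arrival the player must irrevocably accept or reject the current candidate, and accepting terminates the process. $\mathrm{ALG}$ denotes the value of the accepted candidate (0 if none) and $\mathrm{OPT}=\max O$; expectations are over the random choice of $H$ and the algorithm's internal randomness. An algorithm is $c$-competitive if for every $C$ and every adversarial ordering strategy $\mathbb{E}[\mathrm{ALG}]\ge c\,\mathbb{E}[\mathrm{OPT}]$. *)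

theory Defs
  imports "HOL-Probability.Probability"
begin

text \<open>
  A candidate carries a value and a label used only as a tie-breaker: candidates are compared by
  value first and by label second, so distinct candidates may have equal values.
\<close>

datatype candidate = Candidate (val: real) (label: nat)

instantiation candidate :: linorder
begin

definition less_eq_candidate :: "candidate \<Rightarrow> candidate \<Rightarrow> bool" where
  "c \<le> d \<longleftrightarrow> val c < val d \<or> (val c = val d \<and> label c \<le> label d)"

definition less_candidate :: "candidate \<Rightarrow> candidate \<Rightarrow> bool" where
  "c < d \<longleftrightarrow> val c < val d \<or> (val c = val d \<and> label c < label d)"

instance
  by standard
    (auto simp: less_eq_candidate_def less_candidate_def intro: candidate.expand)

end

definition candidate_set :: "nat \<Rightarrow> nat \<Rightarrow> candidate set \<Rightarrow> bool" where
  "candidate_set n h C \<longleftrightarrow> finite C \<and> card C = n + h \<and> (\<forall>c\<in>C. 0 \<le> val c)"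

definition histories :: "nat \<Rightarrow> candidate set \<Rightarrow> candidate set set" where
  "histories h C = {H. H \<subseteq> C \<and> card H = h}"

definition ordering_strategy ::
    "nat \<Rightarrow> candidate set \<Rightarrow> (candidate set \<Rightarrow> candidate list) \<Rightarrow> bool" where
  "ordering_strategy h C \<sigma> \<longleftrightarrow>
     (\<forall>H\<in>histories h C. distinct (\<sigma> H) \<and> set (\<sigma> H) = C - H)"

text \<open>
  A randomized online algorithm draws a seed \<open>s\<close> from a probability space \<open>M\<close>, independently of the
  history. If no candidate has been accepted so far, then \<open>A s n H cs\<close> tells whether the last element
  of the list \<open>cs\<close> of candidates that have arrived up to now is accepted.
\<close>

type_synonym 'r algorithm = "'r \<Rightarrow> nat \<Rightarrow> candidate set \<Rightarrow> candidate list \<Rightarrow> bool"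

definition online_algorithm :: "'r measure \<Rightarrow> 'r algorithm \<Rightarrow> bool" where
  "online_algorithm M A \<longleftrightarrow>
     prob_space M \<and> (\<forall>n H cs. {s \<in> space M. A s n H cs} \<in> sets M)"

text \<open>
  The value obtained from the remaining arrivals (last argument) by a player with accept/reject rule
  \<open>d\<close> who has rejected all candidates in the list \<open>seen\<close>.
\<close>

fun play :: "(candidate list \<Rightarrow> bool) \<Rightarrow> candidate list \<Rightarrow> candidate list \<Rightarrow> real" where
  "play d seen [] = 0"
| "play d seen (c # cs) = (if d (seen @ [c]) then val c else play d (seen @ [c]) cs)"

definition expected_ALG ::
    "'r measure \<Rightarrow> 'r algorithm \<Rightarrow> nat \<Rightarrow> nat \<Rightarrow> candidate set \<Rightarrow>
      (candidate set \<Rightarrow> candidate list) \<Rightarrow> real" where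
  "expected_ALG M A n h C \<sigma> =
     measure_pmf.expectation (pmf_of_set (histories h C))
       (\<lambda>H. \<integral>s. play (A s n H) [] (\<sigma> H) \<partial>M)"

definition expected_OPT :: "nat \<Rightarrow> candidate set \<Rightarrow> real" where
  "expected_OPT h C =
     measure_pmf.expectation (pmf_of_set (histories h C)) (\<lambda>H. val (Max (C - H)))"

definition competitive :: "'r measure \<Rightarrow> 'r algorithm \<Rightarrow> nat \<Rightarrow> nat \<Rightarrow> real \<Rightarrow> bool" where
  "competitive M A n h c \<longleftrightarrow>
     (\<forall>C \<sigma>. candidate_set n h C \<longrightarrow> ordering_strategy h C \<sigma> \<longrightarrow>
        expected_ALG M A n h C \<sigma> \<ge> c * expected_OPT h C)"

end

(*
  The adversary takes sparse values (consecutive ones differ by a factor 1/\<delta>), so that only accepting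
  the overall maximum m counts, and presents the candidates above Max H first, in increasing order.
  When m is the k-th of these, the player wins m only by accepting exactly at position k. Ramsey's
  theorem, applied to the discretized acceptance probabilities, yields an instance on which the
  probability of accepting exactly at the k-th such candidate is essentially a number p k, independent
  of the values; and p 1 + ... + p n \<le> 1. The event that m is online with exactly k candidates above
  Max H is most likely for k = 1, which gives P(m accepted) \<le> n h / ((n + h) (n + h - 1)),
  whereas P(m online) = n / (n + h).
*)

theory Submission
  imports Defs "HOL-Library.Ramsey"
begin

section \<open>Deterministic play with one valuable candidate\<close>

text \<open>Indices start at 1 because \<open>play\<close> never consults the rule on the empty
  list.\<close>

definition stops_at :: "(candidate list \<Rightarrow> bool) \<Rightarrow> candidate list \<Rightarrow> bool" where
  "stops_at d cs \<longleftrightarrow> cs \<noteq> [] \<and> d cs \<and> (\<forall>j\<in>{1..<length cs}. \<not> d (take j cs))"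

lemma play_le:
  assumes "0 \<le> L" "\<forall>c\<in>set cs. val c \<le> L"
  shows "play d seen cs \<le> L"
  using assms by (induction cs arbitrary: seen) auto

text \<open>Either the player accepts at the position of \<open>m\<close>, having rejected
  throughout \<open>pre\<close>, or the payoff is at most \<open>L\<close>. The list
  \<open>seen\<close> is general for the sake of the induction.\<close>

lemma play_append_le:
  assumes "0 \<le> L" "0 \<le> val m" "\<forall>c\<in>set pre \<union> set post. val c \<le> L"
  shows "play d seen (pre @ m # post) \<le> L + val m *
    of_bool (d (seen @ pre @ [m]) \<and> (\<forall>j<length pre. \<not> d (seen @ take (Suc j) pre)))"
  using assms
proof (induction pre arbitrary: seen)
  case Nil
  then show ?case
    using play_le[of L post d "seen @ [m]"] by auto
next
  case (Cons c pre)
  show ?case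
  proof (cases "d (seen @ [c])")
    case True
    then show ?thesis
      using Cons.prems by auto
  next
    case False
    have "(\<forall>j<length (c # pre). \<not> d (seen @ take (Suc j) (c # pre))) \<longleftrightarrow>
      (\<forall>j<length pre. \<not> d ((seen @ [c]) @ take (Suc j) pre))"
      using False by (auto simp: less_Suc_eq_0_disj)
    then show ?thesis
      using Cons.IH[of "seen @ [c]"] Cons.prems False by simp
  qed
qed

lemma play_le_stops_at:
  assumes "0 \<le> L" "0 \<le> val m" "\<forall>c\<in>set pre \<union> set post. val c \<le> L"
  shows "play d [] (pre @ m # post) \<le> L + val m * of_bool (stops_at d (pre @ [m]))"
proof -
  have "(\<forall>j<length pre. \<not> d (take (Suc j) pre)) \<longleftrightarrow>
      (\<forall>j\<in>{1..<length (pre @ [m])}. \<not> d (take j (pre @ [m])))"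
  proof (intro iffI ballI allI impI)
    fix j assume "\<forall>j<length pre. \<not> d (take (Suc j) pre)" "j \<in> {1..<length (pre @ [m])}"
    then show "\<not> d (take j (pre @ [m]))"
      by (cases j) auto
  next
    fix j assume *: "\<forall>j\<in>{1..<length (pre @ [m])}. \<not> d (take j (pre @ [m]))" "j < length pre"
    then have "\<not> d (take (Suc j) (pre @ [m]))"
      by (intro bspec[OF *(1)]) auto
    then show "\<not> d (take (Suc j) pre)"
      using * by simp
  qed
  then show ?thesis
    using play_append_le[OF assms, of d "[]"] by (simp add: stops_at_def)
qed

text \<open>A stopping prefix is accepted, which rules out stopping at any longer prefix. Hence the
  stopping events at different positions are disjoint.\<close>

lemma stops_at_take_unique:
  assumes "stops_at d (take i cs)" "stops_at d (take j cs)" "i \<le> length cs" "j \<le> length cs"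
  shows "i = j"
proof -
  have "\<not> i < j" if "stops_at d (take i cs)" "stops_at d (take j cs)" "j \<le> length cs" for i j
  proof
    assume "i < j"
    moreover have "i \<ge> 1" "d (take i cs)"
      using that(1) by (auto simp: stops_at_def Suc_le_eq)
    moreover have "\<forall>l\<in>{1..<j}. \<not> d (take l (take j cs))"
      using that by (simp add: stops_at_def min_absorb2)
    ultimately show False
      by (auto simp: min_def)
  qed
  then show ?thesis
    using assms by (metis linorder_neqE_nat)
qed

section \<open>Stopping probabilities and expected payoff\<close>

definition stop_prob :: "'r measure \<Rightarrow> 'r algorithm \<Rightarrow> nat \<Rightarrow> candidate set \<Rightarrow> candidate list \<Rightarrow> real"
  where "stop_prob M A n H cs = measure M {s \<in> space M. stops_at (A s n H) cs}"

lemma sets_stops_at: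
  assumes "online_algorithm M A"
  shows "{s \<in> space M. stops_at (A s n H) cs} \<in> sets M"
proof -
  have [measurable]: "Measurable.pred M (\<lambda>s. A s n H cs)" for cs
    using assms by (simp add: online_algorithm_def pred_def)
  show ?thesis
    unfolding stops_at_def by measurable
qed

lemma stop_prob_bounds:
  assumes "online_algorithm M A"
  shows "0 \<le> stop_prob M A n H cs" "stop_prob M A n H cs \<le> 1"
  using assms by (simp_all add: stop_prob_def online_algorithm_def prob_space.prob_le_1)

text \<open>Irrevocable acceptance makes the stopping events disjoint, so all positions share one
  budget of probability. This budget is what limits the player later.\<close>

lemma sum_stop_prob_le_1:
  assumes "online_algorithm M A"
  shows "(\<Sum>k=1..length cs. stop_prob M A n H (take k cs)) \<le> 1"
proof -
  interpret prob_space M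
    using assms by (simp add: online_algorithm_def)
  let ?E = "\<lambda>k. {s \<in> space M. stops_at (A s n H) (take k cs)}"
  have "(\<Sum>k=1..length cs. stop_prob M A n H (take k cs)) = prob (\<Union>k\<in>{1..length cs}. ?E k)"
    unfolding stop_prob_def
    using sets_stops_at[OF assms]
    by (intro finite_measure_finite_Union[symmetric])
      (auto simp: disjoint_family_on_def dest: stops_at_take_unique)
  then show ?thesis
    by simp
qed

lemma integral_play_le:
  assumes "online_algorithm M A"
    and "0 \<le> L" "0 \<le> val m" "\<forall>c\<in>set pre \<union> set post. val c \<le> L"
  shows "(\<integral>s. play (A s n H) [] (pre @ m # post) \<partial>M) \<le> L + val m * stop_prob M A n H (pre @ [m])"
proof -
  interpret prob_space M
    using assms by (simp add: online_algorithm_def)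
  let ?E = "{s \<in> space M. stops_at (A s n H) (pre @ [m])}"
  have E: "?E \<in> sets M"
    using sets_stops_at[OF assms(1)] .
  \<comment> \<open>\<open>integral_mono'\<close> asks for integrability and nonnegativity of the
    upper bound only, so the payoff itself can stay an arbitrary function of the seed.\<close>
  have "(\<integral>s. play (A s n H) [] (pre @ m # post) \<partial>M) \<le> (\<integral>s. L + val m * indicator ?E s \<partial>M)"
  proof (rule integral_mono')
    show "integrable M (\<lambda>s. L + val m * indicator ?E s)"
      using E by (intro Bochner_Integration.integrable_add integrable_mult_right integrable_real_indicator)
        (auto simp: emeasure_eq_measure)
    show "play (A s n H) [] (pre @ m # post) \<le> L + val m * indicator ?E s" if "s \<in> space M" for s
      using play_le_stops_at[OF assms(2-), of "A s n H"] that by (simp add: indicator_def of_bool_def)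
    show "0 \<le> L + val m * indicator ?E s" for s
      using assms by simp
  qed
  also have "\<dots> = L + val m * stop_prob M A n H (pre @ [m])"
    using E by (simp add: stop_prob_def prob_space emeasure_eq_measure)
  finally show ?thesis .
qed

lemma integral_play_le_const:
  assumes "online_algorithm M A" "0 \<le> L" "\<forall>c\<in>set cs. val c \<le> L"
  shows "(\<integral>s. play (A s n H) [] cs \<partial>M) \<le> L"
proof -
  interpret prob_space M
    using assms by (simp add: online_algorithm_def)
  have "(\<integral>s. play (A s n H) [] cs \<partial>M) \<le> (\<integral>s. L \<partial>M)"
    using assms by (intro integral_mono') (auto intro: play_le)
  then show ?thesis
    by (simp add: prob_space)
qed

section \<open>Ramsey's theorem for finitely many colourings\<close>

text \<open>Ramsey's theorem is applied to one colouring after another, each time inside the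
  infinite set found before; constancy of the earlier colourings survives passing to a
  subset.\<close>

lemma Ramsey_simultaneous:
  fixes Z :: "'a set" and f :: "'b \<Rightarrow> 'a set \<Rightarrow> nat"
  assumes "finite I" "infinite Z"
    and "\<And>i X. i \<in> I \<Longrightarrow> f i X < s"
  shows "\<exists>Y t. Y \<subseteq> Z \<and> infinite Y \<and> (\<forall>i\<in>I. \<forall>X. X \<subseteq> Y \<and> finite X \<and> card X = r i \<longrightarrow> f i X = t i)"
  using assms(1,3)
proof (induction I rule: finite_induct)
  case empty
  then show ?case
    using assms(2) by auto
next
  case (insert i I)
  then obtain Y t where Y: "Y \<subseteq> Z" "infinite Y"
    and t: "\<forall>i\<in>I. \<forall>X. X \<subseteq> Y \<and> finite X \<and> card X = r i \<longrightarrow> f i X = t i"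
    by (auto simp: Ball_def)
  obtain Y' u where Y': "Y' \<subseteq> Y" "infinite Y'"
    and u: "\<forall>X. X \<subseteq> Y' \<and> finite X \<and> card X = r i \<longrightarrow> f i X = u"
    using Ramsey[OF Y(2), of "r i" "f i" s] insert.prems by auto
  have "\<forall>j\<in>insert i I. \<forall>X. X \<subseteq> Y' \<and> finite X \<and> card X = r j \<longrightarrow> f j X = (t(i := u)) j"
    using t u Y'(1) insert.hyps by auto
  then show ?case
    using Y(1) Y' by blast
qed

section \<open>Counting histories with a prescribed maximum\<close>

text \<open>Such an \<open>H\<close> contains \<open>c\<close> and avoids \<open>m\<close>, so
  deleting \<open>c\<close> maps these sets injectively to the subsets of \<open>C - {m, c}\<close>
  of size \<open>h - 1\<close>.\<close>

lemma card_subsets_Max_le: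
  fixes C :: "'a::linorder set"
  assumes "finite C" "m \<in> C" "1 \<le> h"
  shows "card {H. H \<subseteq> C \<and> card H = h \<and> m \<notin> H \<and> Max H = c} \<le> (card C - 2) choose (h - 1)"
proof -
  let ?F = "{H. H \<subseteq> C \<and> card H = h \<and> m \<notin> H \<and> Max H = c}"
  have mem: "c \<in> H" "finite H" if "H \<in> ?F" for H
  proof -
    show "finite H"
      using that assms(1) by (auto intro: finite_subset)
    moreover have "H \<noteq> {}"
      using that assms(3) by auto
    ultimately show "c \<in> H"
      using that Max_in by blast
  qed
  show ?thesis
  proof (cases "?F = {}")
    case True
    then show ?thesis
      by (metis card.empty zero_le)
  next
    case False
    \<comment> \<open>Any member of the family shows that \<open>c\<close> is in \<open>C\<close>
      and differs from \<open>m\<close>, so exactly two elements are removed from \<open>C\<close>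
      below.\<close>
    then have c: "c \<in> C" "c \<noteq> m"
      using mem by blast+
    have "card ?F \<le> card {B. B \<subseteq> C - {m, c} \<and> card B = h - 1}"
    proof (rule card_inj_on_le)
      show "inj_on (\<lambda>H. H - {c}) ?F"
        proof (rule inj_onI)
        fix H H' assume "H \<in> ?F" "H' \<in> ?F" "H - {c} = H' - {c}"
        then show "H = H'"
          using mem(1)[of H] mem(1)[of H'] insert_Diff[of c H] insert_Diff[of c H'] by metis
      qed
      show "(\<lambda>H. H - {c}) ` ?F \<subseteq> {B. B \<subseteq> C - {m, c} \<and> card B = h - 1}"
      proof (rule image_subsetI)
        fix H assume "H \<in> ?F"
        then show "H - {c} \<in> {B. B \<subseteq> C - {m, c} \<and> card B = h - 1}"
          using mem[of H] card_Diff_singleton[of c H] by blast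
      qed
      show "finite {B. B \<subseteq> C - {m, c} \<and> card B = h - 1}"
        using assms by simp
    qed
    also have "\<dots> = card (C - {m, c}) choose (h - 1)"
      using assms by (intro n_subsets) simp
    also have "card (C - {m, c}) = card C - 2"
      using assms c by (simp add: card_Diff_subset)
    finally show ?thesis .
  qed
qed

text \<open>The left side is the probability that a uniform \<open>h\<close>-subset of
  \<open>n + h\<close> elements contains one given element and misses another. The right side is
  grouped so that its last factor is the probability of missing a given element.\<close>

lemma choose_minus_2_div:
  assumes "n \<ge> 1" "h \<ge> 1"
  shows "real ((n + h - 2) choose (h - 1)) / real ((n + h) choose h) =
    real h / (real n + real h - 1) * (real n / (real n + real h))"
proof -
  obtain a b where ab: "n = Suc a" "h = Suc b"
    using assms by (metis Suc_le_D One_nat_def)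
  have 1: "Suc b * (Suc (Suc (a + b)) choose Suc b) = Suc (Suc (a + b)) * (Suc (a + b) choose b)"
    by (rule Suc_times_binomial)
  \<comment> \<open>This is the absorption identity for the complementary lower index; symmetry of
    the binomial coefficients translates it back.\<close>
  have 2: "Suc a * (Suc (a + b) choose b) = Suc (a + b) * ((a + b) choose b)"
    using Suc_times_binomial[of a "a + b"] binomial_symmetric[of b "Suc (a + b)"] binomial_symmetric[of b "a + b"]
    by (simp add: Suc_diff_le)
  define x y z where "x = real (Suc (Suc (a + b)) choose Suc b)"
    "y = real (Suc (a + b) choose b)" "z = real ((a + b) choose b)"
  have "(1 + real b) * x = (2 + real a + real b) * y" "(1 + real a) * y = (1 + real a + real b) * z"
    using 1 2 unfolding x_y_z_def of_nat_eq_iff[where 'a=real, symmetric] of_nat_mult by simp_all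
  moreover have "x > 0"
    unfolding x_y_z_def by (simp add: zero_less_binomial_iff del: binomial_Suc_Suc)
  ultimately have "z / x = (1 + real b) / (1 + real a + real b) * ((1 + real a) / (2 + real a + real b))"
    by (simp add: divide_simps) algebra
  then show ?thesis
    unfolding ab x_y_z_def by (simp add: add_ac)
qed


section \<open>An instance with almost constant stopping probabilities\<close>

text \<open>
  The history is the set of the \<open>h\<close> smallest elements of \<open>X\<close>, the arrivals are the others in
  increasing order. Any \<open>X \<subseteq> C\<close> of size \<open>h + k\<close> is assigned the same probability up to \<open>\<delta>\<close>.
\<close>

lemma exists_stationary_instance:
  assumes alg: "online_algorithm M A" and Z: "infinite Z" and "0 < \<delta>"
  shows "\<exists>C p. C \<subseteq> Z \<and> finite C \<and> card C = n + h \<and> (\<forall>k. 0 \<le> p k) \<and> (\<Sum>k=1..n. p k) \<le> 1 \<and>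
    (\<forall>k\<in>{1..n}. \<forall>X. X \<subseteq> C \<and> card X = h + k \<longrightarrow>
      stop_prob M A n (set (take h (sorted_list_of_set X))) (drop h (sorted_list_of_set X))
        \<le> p k + \<delta>)"
proof -
  let ?q = "\<lambda>X. stop_prob M A n (set (take h (sorted_list_of_set X))) (drop h (sorted_list_of_set X))"
  \<comment> \<open>Rounding down to multiples of \<open>\<delta>\<close> leaves finitely many
    colours. One colouring serves every \<open>k\<close>; only the subset size \<open>h + k\<close>
    varies.\<close>
  let ?f = "\<lambda>X. nat \<lfloor>?q X / \<delta>\<rfloor>"
  have f_less: "?f X < Suc (nat \<lfloor>1 / \<delta>\<rfloor>)" for X
    using stop_prob_bounds[OF alg] \<open>0 < \<delta>\<close>
    by (intro le_imp_less_Suc nat_mono floor_mono divide_right_mono) auto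
  obtain Y t where Y: "Y \<subseteq> Z" "infinite Y"
    and t: "\<forall>k\<in>{1..n}. \<forall>X. X \<subseteq> Y \<and> finite X \<and> card X = h + k \<longrightarrow> ?f X = t k"
    using Ramsey_simultaneous[of "{1..n}" Z "\<lambda>_. ?f" "Suc (nat \<lfloor>1 / \<delta>\<rfloor>)" "\<lambda>k. h + k"] Z f_less
    by auto
  obtain C where C: "C \<subseteq> Y" "finite C" "card C = n + h"
    using infinite_arbitrarily_large[OF Y(2)] by blast
  define p where "p k = real (t k) * \<delta>" for k
  have approx: "p k \<le> ?q X" "?q X \<le> p k + \<delta>" if "k \<in> {1..n}" "X \<subseteq> C" "card X = h + k" for k X
  proof -
    have "?f X = t k"
      using t that C finite_subset[of X C] by blast
    moreover have "0 \<le> ?q X / \<delta>"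
      using stop_prob_bounds[OF alg] \<open>0 < \<delta>\<close> by auto
    ultimately have "real (t k) = of_int \<lfloor>?q X / \<delta>\<rfloor>"
      by (metis of_nat_nat zero_le_floor)
    then have "real (t k) \<le> ?q X / \<delta>" "?q X / \<delta> \<le> real (t k) + 1"
      by linarith+
    then show "p k \<le> ?q X" "?q X \<le> p k + \<delta>"
      using \<open>0 < \<delta>\<close> by (simp_all add: p_def field_simps)
  qed
  define xs where "xs = sorted_list_of_set C"
  have xs: "sorted xs" "distinct xs" "set xs = C" "length xs = n + h"
    using C by (simp_all add: xs_def)
  \<comment> \<open>For all \<open>k\<close>, the \<open>h + k\<close> smallest elements of
    \<open>C\<close> yield the same history, and their arrivals are the successive prefixes of a
    single list. So one budget of probability bounds all the \<open>p k\<close> together.\<close>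
  have "p k \<le> stop_prob M A n (set (take h xs)) (take k (drop h xs))" if "k \<in> {1..n}" for k
  proof -
    have "sorted_list_of_set (set (take (h + k) xs)) = take (h + k) xs"
      using xs by (intro sorted_distinct_set_unique) (auto simp: sorted_wrt_take)
    moreover have "card (set (take (h + k) xs)) = h + k"
      using xs that by (subst distinct_card) auto
    moreover have "set (take (h + k) xs) \<subseteq> C"
      using set_take_subset xs(3) by fast
    ultimately show ?thesis
      using approx(1)[of k "set (take (h + k) xs)"] that by (simp add: min_def drop_take)
  qed
  then have "(\<Sum>k=1..n. p k) \<le> (\<Sum>k=1..n. stop_prob M A n (set (take h xs)) (take k (drop h xs)))"
    by (intro sum_mono)
  also have "\<dots> \<le> 1"
    using sum_stop_prob_le_1[OF alg, where cs = "drop h xs"] xs by simp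
  finally have "(\<Sum>k=1..n. p k) \<le> 1" .
  moreover have "\<forall>k. 0 \<le> p k"
    using \<open>0 < \<delta>\<close> by (simp add: p_def)
  ultimately show ?thesis
    using C Y(1) approx(2) by (intro exI[of _ C] exI[of _ p]) auto
qed

section \<open>Averaging over the histories that miss \<open>m\<close>\<close>

text \<open>Histories are grouped by the number \<open>k\<close> of elements above their maximum.
  Every group obeys the same bound, so it factors out of the sum. If \<open>m\<close> is the maximum
  of \<open>C\<close>, the bound is attained at \<open>k = 1\<close>.\<close>

lemma sum_above_Max_le:
  fixes C :: "'a::linorder set" and p :: "nat \<Rightarrow> real"
  assumes C: "finite C" "card C = n + h" "m \<in> C" and "1 \<le> h" and p: "\<And>k. 0 \<le> p k"
    and G: "G = {H. H \<subseteq> C \<and> card H = h \<and> m \<notin> H}"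
    and above: "\<And>H. H \<in> G \<Longrightarrow> card {x \<in> C. Max H < x} \<in> {1..n}"
  shows "(\<Sum>H\<in>G. p (card {x \<in> C. Max H < x})) \<le> real ((n + h - 2) choose (h - 1)) * (\<Sum>k=1..n. p k)"
proof -
  let ?k = "\<lambda>H. card {x \<in> C. Max H < x}"
  have finG: "finite G"
    unfolding G using C by simp
  have Max_mem: "Max H \<in> C" if "H \<in> G" for H
  proof -
    have "finite H" "H \<noteq> {}"
      using that C \<open>1 \<le> h\<close> finite_subset[of H C] by (auto simp: G)
    then show ?thesis
      using Max_in[of H] that unfolding G by blast
  qed
  \<comment> \<open>An element of \<open>C\<close> is determined by how many elements lie above it,
    so fixing \<open>k\<close> fixes \<open>Max H\<close>.\<close>
  have k_inj: "c = d" if "c \<in> C" "d \<in> C" "card {x \<in> C. c < x} = card {x \<in> C. d < x}" for c d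
  proof (rule ccontr)
    assume "c \<noteq> d"
    have less: "card {x \<in> C. b < x} < card {x \<in> C. a < x}" if "a < b" "b \<in> C" for a b
      using that C by (intro psubset_card_mono) auto
    show False
      using less[of c d] less[of d c] that \<open>c \<noteq> d\<close> by (auto simp: neq_iff)
  qed
  have fibre: "card {H \<in> G. ?k H = k} \<le> (n + h - 2) choose (h - 1)" for k
  proof (cases "{H \<in> G. ?k H = k} = {}")
    case True
    then show ?thesis
      by (metis card.empty zero_le)
  next
    case False
    then obtain H0 where H0: "H0 \<in> G" "?k H0 = k"
      by blast
    have "{H \<in> G. ?k H = k} \<subseteq> {H. H \<subseteq> C \<and> card H = h \<and> m \<notin> H \<and> Max H = Max H0}"
    proof (rule subsetI)
      fix H assume H: "H \<in> {H \<in> G. ?k H = k}"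
      then have "Max H = Max H0"
        using k_inj Max_mem H0 by simp
      with H show "H \<in> {H. H \<subseteq> C \<and> card H = h \<and> m \<notin> H \<and> Max H = Max H0}"
        by (simp add: G)
    qed
    then have "card {H \<in> G. ?k H = k} \<le> card {H. H \<subseteq> C \<and> card H = h \<and> m \<notin> H \<and> Max H = Max H0}"
      using C by (intro card_mono) simp_all
    also have "\<dots> \<le> (n + h - 2) choose (h - 1)"
      using card_subsets_Max_le[OF C(1,3) \<open>1 \<le> h\<close>] C(2) by simp
    finally show ?thesis .
  qed
  have "(\<Sum>H\<in>G. p (?k H)) = (\<Sum>k=1..n. \<Sum>H | H \<in> G \<and> ?k H = k. p (?k H))"
    using above by (intro sum.group[symmetric] finG) auto
  also have "\<dots> = (\<Sum>k=1..n. real (card {H \<in> G. ?k H = k}) * p k)"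
    by (intro sum.cong) auto
  also have "\<dots> \<le> (\<Sum>k=1..n. real ((n + h - 2) choose (h - 1)) * p k)"
    using fibre p by (intro sum_mono mult_right_mono) simp_all
  finally show ?thesis
    by (simp add: sum_distrib_left)
qed

section \<open>The adversarial order and bounds on ALG and OPT\<close>

text \<open>For nonempty \<open>H\<close>, each arrival in the first block is a new record over the
  history and all earlier arrivals. The maximum of \<open>C\<close>, if online, closes this
  block.\<close>

definition increasing_first :: "candidate set \<Rightarrow> candidate set \<Rightarrow> candidate list" where
  "increasing_first C H = sorted_list_of_set {x \<in> C. Max H < x} @
     sorted_list_of_set {x \<in> C - H. x \<le> Max H}"

lemma ordering_strategy_increasing_first:
  assumes "finite C" "h \<ge> 1"
  shows "ordering_strategy h C (increasing_first C)"
  unfolding ordering_strategy_def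
proof
  fix H assume "H \<in> histories h C"
  then have "H \<subseteq> C" "finite H"
    using assms finite_subset by (auto simp: histories_def)
  \<comment> \<open>Hence the condition \<open>Max H < x\<close> already excludes \<open>H\<close>
    from the first block.\<close>
  then have "\<forall>x\<in>H. x \<le> Max H"
    by simp
  then show "distinct (increasing_first C H) \<and> set (increasing_first C H) = C - H"
    using assms by (auto simp: increasing_first_def not_le not_less)
qed

text \<open>If \<open>m\<close> is in the history, every arrival is worth at most
  \<open>\<delta> * val m\<close>. Otherwise \<open>m\<close> ends the first block, and gaining it
  means stopping exactly at the end of that block.\<close>

lemma integral_play_increasing_first_le:
  assumes alg: "online_algorithm M A"
    and C: "finite C" "H \<subseteq> C" "H \<noteq> {}" "m = Max C" "0 \<le> \<delta>"
    and val: "\<And>x. x \<in> C \<Longrightarrow> 0 < val x"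
    and sparse: "\<And>x. x \<in> C \<Longrightarrow> x \<noteq> m \<Longrightarrow> val x \<le> \<delta> * val m"
  shows "(\<integral>s. play (A s n H) [] (increasing_first C H) \<partial>M) \<le> \<delta> * val m +
    (if m \<in> H then 0 else val m * stop_prob M A n H (sorted_list_of_set {x \<in> C. Max H < x}))"
proof -
  have "C \<noteq> {}"
    using C by blast
  then have m: "m \<in> C" "\<And>x. x \<in> C \<Longrightarrow> x \<le> m"
    using C by simp_all
  have H: "finite H" "\<forall>x\<in>H. x \<le> Max H" "Max H \<in> H"
    using C finite_subset[of H C] by simp_all
  have pos: "0 < val m" "0 \<le> \<delta> * val m"
    using m val[of m] C by auto
  show ?thesis
  proof (cases "m \<in> H")
    case True
    have "set (increasing_first C H) \<subseteq> C - H"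
      using C H by (auto simp: increasing_first_def not_le)
    then have "\<forall>c\<in>set (increasing_first C H). val c \<le> \<delta> * val m"
      using sparse True by blast
    then show ?thesis
      using integral_play_le_const[OF alg pos(2)] True by simp
  next
    case False
    let ?U = "{x \<in> C. Max H < x}"
    have "Max H < m"
      using H m C False by (metis le_neq_trans subsetD)
    then have "sorted_list_of_set ?U = sorted_list_of_set (?U - {m}) @ [m]"
      using C m by (intro sorted_distinct_set_unique) (auto simp: sorted_append)
    moreover have "set (sorted_list_of_set (?U - {m})) \<union> set (sorted_list_of_set {x \<in> C - H. x \<le> Max H}) \<subseteq> C - {m}"
      using C \<open>Max H < m\<close> by auto
    then have "\<forall>c\<in>set (sorted_list_of_set (?U - {m})) \<union> set (sorted_list_of_set {x \<in> C - H. x \<le> Max H}). val c \<le> \<delta> * val m"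
      using sparse by blast
    ultimately show ?thesis
      using integral_play_le[OF alg pos(2), of m "sorted_list_of_set (?U - {m})"
          "sorted_list_of_set {x \<in> C - H. x \<le> Max H}" n H] pos False
      by (simp add: increasing_first_def)
  qed
qed

text \<open>Only histories that miss \<open>m\<close> are counted, each contributing
  \<open>val m\<close>; they form a fraction \<open>n / (n + h)\<close> of all histories, and the
  others contribute nonnegative amounts.\<close>

lemma expected_OPT_ge:
  assumes C: "finite C" "card C = n + h" "n \<ge> 1" "m = Max C"
    and val: "\<And>x. x \<in> C \<Longrightarrow> 0 < val x"
  shows "val m * (real n / (real n + real h)) \<le> expected_OPT h C"
proof -
  have ne: "C - H \<noteq> {}" if "H \<in> histories h C" for H
  proof
    assume "C - H = {}"
    with that have "H = C" "card H = h"
      unfolding histories_def by blast+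
    then show False
      using C(2,3) by simp
  qed
  have "C \<noteq> {}"
    using C(2,3) by auto
  then have m: "m \<in> C" "\<And>x. x \<in> C \<Longrightarrow> x \<le> m"
    using C by auto
  have fin: "finite (histories h C)" and card: "card (histories h C) = (n + h) choose h"
    using C n_subsets[of C h] by (simp_all add: histories_def)
  then have "histories h C \<noteq> {}"
    by (auto simp: card_eq_0_iff[symmetric])
  then have eq: "expected_OPT h C = (\<Sum>H\<in>histories h C. val (Max (C - H))) / real ((n + h) choose h)"
    using fin card by (simp add: expected_OPT_def integral_pmf_of_set)
  let ?G = "{H. H \<subseteq> C - {m} \<and> card H = h}"
  have "card ?G = (n + h - 1) choose h"
    using C m n_subsets[of "C - {m}" h] by simp
  then have "real ((n + h - 1) choose h) * val m = (\<Sum>H\<in>?G. val m)"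
    by simp
  also have "\<dots> = (\<Sum>H\<in>?G. val (Max (C - H)))"
  proof (rule sum.cong)
    fix H assume "H \<in> ?G"
    then have "Max (C - H) = m"
      using m C by (intro Max_eqI) auto
    then show "val m = val (Max (C - H))"
      by simp
  qed simp
  also have "\<dots> \<le> (\<Sum>H\<in>histories h C. val (Max (C - H)))"
  proof (rule sum_mono2[OF fin])
    show "?G \<subseteq> histories h C"
      by (auto simp: histories_def)
    fix H assume "H \<in> histories h C - ?G"
    then have "Max (C - H) \<in> C"
      using ne[of H] C Max_in[of "C - H"] by auto
    then show "0 \<le> val (Max (C - H))"
      using val by (simp add: less_imp_le)
  qed
  finally have "real ((n + h - 1) choose h) * val m / real ((n + h) choose h) \<le> expected_OPT h C"
    unfolding eq by (intro divide_right_mono) auto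
  moreover have "real ((n + h - 1) choose h) / real ((n + h) choose h) = real n / (real n + real h)"
  proof -
    obtain a where a: "n = Suc a"
      using C by (metis Suc_le_D One_nat_def)
    have "Suc (a + h) * ((a + h) choose h) = (Suc (a + h) choose h) * Suc a"
      using Suc_times_binomial_eq[of "a + h" a] binomial_symmetric[of h "a + h"] binomial_symmetric[of h "Suc (a + h)"]
      by (simp add: Suc_diff_le)
    then have "real (Suc (a + h)) * real ((a + h) choose h) = real (Suc (a + h) choose h) * real (Suc a)"
      by (metis of_nat_mult)
    moreover have "real (Suc (a + h) choose h) > 0"
      by (simp add: zero_less_binomial_iff)
    ultimately show ?thesis
      unfolding a by (simp add: field_simps)
  qed
  ultimately show ?thesis
    by (metis mult.commute times_divide_eq_left)
qed

lemma infinite_powers: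
  assumes "1 < (K::real)"
  shows "infinite (range (\<lambda>i. Candidate (K ^ i) 0))"
  using assms by (intro range_inj_infinite injI) simp

section \<open>The hard instance\<close>

text \<open>Here \<open>v\<close> is the value of the overall maximum. One \<open>\<delta>\<close>
  of the error pays for accepting a smaller candidate, the other for the rounding of the stopping
  probabilities.\<close>

lemma exists_hard_instance:
  assumes "n \<ge> 1" "h \<ge> 1" and alg: "online_algorithm M A" and "0 < \<delta>" "\<delta> < 1"
  shows "\<exists>C. candidate_set n h C \<and> ordering_strategy h C (increasing_first C) \<and>
    (\<exists>v>0. v * (real n / (real n + real h)) \<le> expected_OPT h C \<and>
      expected_ALG M A n h C (increasing_first C) \<le>
        v * (real h / (real n + real h - 1) * (real n / (real n + real h)) + 2 * \<delta>))"
proof -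
  \<comment> \<open>Distinct powers give distinct values, so the label can be constant.\<close>
  define Z where "Z = range (\<lambda>i. Candidate ((1 / \<delta>) ^ i) 0)"
  have "infinite Z"
    unfolding Z_def using assms by (intro infinite_powers) simp
  then obtain C p where C: "C \<subseteq> Z" "finite C" "card C = n + h"
    and p: "\<forall>k. 0 \<le> p k" "(\<Sum>k=1..n. p k) \<le> 1"
    and stop: "\<forall>k\<in>{1..n}. \<forall>X. X \<subseteq> C \<and> card X = h + k \<longrightarrow>
      stop_prob M A n (set (take h (sorted_list_of_set X))) (drop h (sorted_list_of_set X)) \<le> p k + \<delta>"
    using exists_stationary_instance[OF alg _ \<open>0 < \<delta>\<close>, of Z n h] by blast
  have val: "0 < val x" if "x \<in> C" for x
    using that C(1) assms by (auto simp: Z_def)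
  define m where "m = Max C"
  have "C \<noteq> {}"
    using C assms by auto
  then have m: "m \<in> C" "\<And>x. x \<in> C \<Longrightarrow> x \<le> m"
    using C by (auto simp: m_def)
  have sparse: "val x \<le> \<delta> * val m" if "x \<in> C" "x \<noteq> m" for x
  proof -
    have "x \<in> Z" "m \<in> Z"
      using that(1) m(1) C(1) by blast+
    then obtain i j where ij: "x = Candidate ((1 / \<delta>) ^ i) 0" "m = Candidate ((1 / \<delta>) ^ j) 0"
      unfolding Z_def by blast
    moreover have "x < m"
      using that m(2)[of x] by simp
    ultimately have "(1 / \<delta>) ^ i < (1 / \<delta>) ^ j"
      by (simp add: less_candidate_def)
    then have "i < j"
      using assms by (subst (asm) power_strict_increasing_iff) auto
    \<comment> \<open>Exponents are integers, so a strict inequality gains a full factor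
      \<open>1 / \<delta>\<close>.\<close>
    then have "(1 / \<delta>) ^ Suc i \<le> (1 / \<delta>) ^ j"
      using assms by (intro power_increasing) auto
    then have "\<delta> * (1 / \<delta>) ^ Suc i \<le> \<delta> * (1 / \<delta>) ^ j"
      using assms by (intro mult_left_mono) auto
    then show ?thesis
      using assms ij by simp
  qed
  let ?v = "val m"
  have v: "0 < ?v"
    using val m by simp
  let ?k = "\<lambda>H. card {x \<in> C. Max H < x}"
  define Hs where "Hs = histories h C"
  define G where "G = {H. H \<subseteq> C \<and> card H = h \<and> m \<notin> H}"
  have Hs: "finite Hs" "card Hs = (n + h) choose h"
    using C n_subsets[of C h] by (simp_all add: Hs_def histories_def)
  then have "Hs \<noteq> {}"
    by (auto simp: card_eq_0_iff[symmetric])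
  have G_sub: "G \<subseteq> Hs"
    by (auto simp: G_def Hs_def histories_def)
  have hist: "H \<subseteq> C" "finite H" "H \<noteq> {}" "card H = h" if "H \<in> Hs" for H
    using that C assms finite_subset[of H C] by (auto simp: Hs_def histories_def)
  \<comment> \<open>The maximum \<open>m\<close> itself lies above \<open>Max H\<close>, and
    whatever lies above \<open>Max H\<close> is among the \<open>n\<close> online
    candidates.\<close>
  have above: "?k H \<in> {1..n}" if "H \<in> G" for H
  proof -
    note H = hist[OF subsetD[OF G_sub that]]
    have "Max H \<in> H" "m \<notin> H"
      using H that by (auto simp: G_def)
    then have "Max H < m"
      using H m(2) by (metis le_neq_trans subsetD)
    then have "m \<in> {x \<in> C. Max H < x}"
      using m by simp
    moreover have fin: "finite {x \<in> C. Max H < x}"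
      using C by simp
    ultimately have "?k H \<ge> 1"
      by (metis One_nat_def Suc_leI card_gt_0_iff empty_iff)
    have "{x \<in> C. Max H < x} \<subseteq> C - H"
      using H by (auto simp: not_less)
    then have "?k H \<le> card (C - H)"
      using C by (intro card_mono) auto
    also have "\<dots> = n"
      using C H by (simp add: card_Diff_subset)
    finally show ?thesis
      using \<open>?k H \<ge> 1\<close> by simp
  qed
  have stop_H: "stop_prob M A n H (sorted_list_of_set {x \<in> C. Max H < x}) \<le> p (?k H) + \<delta>"
    if "H \<in> G" for H
  proof -
    note H = hist[OF subsetD[OF G_sub that]]
    let ?U = "{x \<in> C. Max H < x}"
    have le: "\<forall>x\<in>H. x \<le> Max H"
      using H by simp
    have "finite ?U"
      using C by simp
    \<comment> \<open>With \<open>card H = h\<close>, cutting this list after \<open>h\<close>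
      entries recovers the actual history and first block, so the stationarity bound applies with
      \<open>X = H \<union> ?U\<close>.\<close>
    have eq: "sorted_list_of_set (H \<union> ?U) = sorted_list_of_set H @ sorted_list_of_set ?U"
      using H \<open>finite ?U\<close> le
      by (intro sorted_distinct_set_unique) (force simp: sorted_append)+
    have "card (H \<union> ?U) = h + ?k H"
      using H \<open>finite ?U\<close> le by (subst card_Un_disjoint) auto
    moreover have "H \<union> ?U \<subseteq> C"
      using H by auto
    ultimately have "stop_prob M A n (set (take h (sorted_list_of_set (H \<union> ?U))))
        (drop h (sorted_list_of_set (H \<union> ?U))) \<le> p (?k H) + \<delta>"
      using stop above[OF that] by blast
    then show ?thesis
      using H unfolding eq by simp
  qed
  let ?B = "real ((n + h - 2) choose (h - 1))"
  let ?I = "\<lambda>H. \<integral>s. play (A s n H) [] (increasing_first C H) \<partial>M"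
  have "(\<Sum>H\<in>Hs. ?I H) \<le> (\<Sum>H\<in>Hs. 2 * \<delta> * ?v + (if H \<in> G then ?v * p (?k H) else 0))"
  proof (rule sum_mono)
    fix H assume "H \<in> Hs"
    note H = hist[OF this]
    have I: "?I H \<le> \<delta> * ?v +
        (if m \<in> H then 0 else ?v * stop_prob M A n H (sorted_list_of_set {x \<in> C. Max H < x}))"
      using H C assms m_def val sparse by (intro integral_play_increasing_first_le[OF alg]) auto
    have "0 \<le> \<delta> * ?v"
      using v assms by simp
    show "?I H \<le> 2 * \<delta> * ?v + (if H \<in> G then ?v * p (?k H) else 0)"
    proof (cases "m \<in> H")
      case True
      then show ?thesis
        using I \<open>0 \<le> \<delta> * ?v\<close> by (simp add: G_def)
    next
      case False
      then have "H \<in> G"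
        using H by (simp add: G_def)
      then show ?thesis
        using I False mult_left_mono[OF stop_H[OF \<open>H \<in> G\<close>], of ?v] v by (simp add: algebra_simps)
    qed
  qed
  also have "\<dots> = real (card Hs) * (2 * \<delta> * ?v) + ?v * (\<Sum>H\<in>G. p (?k H))"
    using Hs G_sub by (simp add: sum.distrib sum.inter_restrict[symmetric] Int_absorb1 sum_distrib_left)
  also have "(\<Sum>H\<in>G. p (?k H)) \<le> ?B * (\<Sum>k=1..n. p k)"
    using C m p assms above by (intro sum_above_Max_le[OF _ _ m(1) _ _ G_def]) auto
  also have "\<dots> \<le> ?B * 1"
    using p by (intro mult_left_mono) auto
  finally have "(\<Sum>H\<in>Hs. ?I H) \<le> real (card Hs) * (2 * \<delta> * ?v) + ?v * ?B"
    using v by simp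
  moreover have "card Hs > 0"
    using Hs \<open>Hs \<noteq> {}\<close> by (simp add: card_gt_0_iff)
  ultimately have "(\<Sum>H\<in>Hs. ?I H) / real (card Hs) \<le> ?v * (?B / real (card Hs) + 2 * \<delta>)"
    by (simp add: field_simps)
  moreover have "expected_ALG M A n h C (increasing_first C) = (\<Sum>H\<in>Hs. ?I H) / real (card Hs)"
    using Hs \<open>Hs \<noteq> {}\<close> by (simp add: expected_ALG_def Hs_def integral_pmf_of_set)
  moreover have "?B / real (card Hs) = real h / (real n + real h - 1) * (real n / (real n + real h))"
    using choose_minus_2_div[OF assms(1,2)] Hs by simp
  ultimately have "expected_ALG M A n h C (increasing_first C) \<le>
      ?v * (real h / (real n + real h - 1) * (real n / (real n + real h)) + 2 * \<delta>)"
    by simp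
  moreover have "?v * (real n / (real n + real h)) \<le> expected_OPT h C"
    using C assms m_def val by (intro expected_OPT_ge) auto
  moreover have "candidate_set n h C"
    using C val by (auto simp: candidate_set_def less_imp_le)
  moreover have "ordering_strategy h C (increasing_first C)"
    using C assms by (intro ordering_strategy_increasing_first)
  ultimately show ?thesis
    using v by blast
qed

section \<open>From the hard instance to the competitive ratio\<close>

theorem theorem2:
  fixes n h :: nat and M :: "'r measure" and A :: "'r algorithm"
  assumes "n \<ge> 1" and "h \<ge> 1" and "online_algorithm M A"
  shows "(\<forall>c. competitive M A n h c \<longrightarrow> c \<le> real h / (real n + real h - 1)) \<and>
    (\<forall>\<epsilon>>0. \<exists>C \<sigma>. candidate_set n h C \<and> ordering_strategy h C \<sigma> \<and> expected_OPT h C > 0 \<and>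
       expected_ALG M A n h C \<sigma> \<le> (real h / (real n + real h - 1) + \<epsilon>) * expected_OPT h C)"
proof -
  let ?r = "real h / (real n + real h - 1)"
  let ?s = "real n / (real n + real h)"
  have upper: "\<exists>C \<sigma>. candidate_set n h C \<and> ordering_strategy h C \<sigma> \<and> expected_OPT h C > 0 \<and>
       expected_ALG M A n h C \<sigma> \<le> (?r + \<epsilon>) * expected_OPT h C" if "\<epsilon> > 0" for \<epsilon> :: real
  proof -
    have s: "?s > 0" and r: "?r \<ge> 0"
      using assms by auto
    \<comment> \<open>The additive error \<open>2 * \<delta> * v\<close> has to fit into
      \<open>\<epsilon> * ?s * v\<close>, which is at most \<open>\<epsilon>\<close> times the
      expected optimum.\<close>
    have "\<exists>\<delta>. 0 < \<delta> \<and> \<delta> < 1 \<and> 2 * \<delta> \<le> t" if "t > 0" for t :: real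
      using that by (intro exI[of _ "min (1 / 2) (t / 2)"]) (auto simp: min_def)
    then obtain \<delta> where \<delta>: "0 < \<delta>" "\<delta> < 1" "2 * \<delta> \<le> \<epsilon> * ?s"
      using mult_pos_pos[OF \<open>\<epsilon> > 0\<close> s] by blast
    obtain C v where C: "candidate_set n h C" "ordering_strategy h C (increasing_first C)"
      and v: "v > 0" "v * ?s \<le> expected_OPT h C"
        "expected_ALG M A n h C (increasing_first C) \<le> v * (?r * ?s + 2 * \<delta>)"
      using exists_hard_instance[OF assms \<delta>(1,2)] by blast
    have "v * (?r * ?s + 2 * \<delta>) \<le> v * (?r * ?s + \<epsilon> * ?s)"
      using v \<delta> by (intro mult_left_mono) auto
    also have "\<dots> = (?r + \<epsilon>) * (v * ?s)"
      by (simp only: distrib_left distrib_right mult_ac)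
    also have "\<dots> \<le> (?r + \<epsilon>) * expected_OPT h C"
      using v r that by (intro mult_left_mono) auto
    finally have "expected_ALG M A n h C (increasing_first C) \<le> (?r + \<epsilon>) * expected_OPT h C"
      using v by linarith
    moreover have "expected_OPT h C > 0"
      using mult_pos_pos[OF v(1) s] v(2) by linarith
    ultimately show ?thesis
      using C by blast
  qed
  have "c \<le> ?r" if "competitive M A n h c" for c
  proof (rule field_le_epsilon)
    fix \<epsilon> :: real assume "\<epsilon> > 0"
    then obtain C \<sigma> where *: "candidate_set n h C" "ordering_strategy h C \<sigma>" "expected_OPT h C > 0"
      "expected_ALG M A n h C \<sigma> \<le> (?r + \<epsilon>) * expected_OPT h C"
      using upper by blast
    \<comment> \<open>The expected optimum is positive and cancels; letting
      \<open>\<epsilon>\<close> tend to 0 then gives the bound on \<open>c\<close>.\<close>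
    then have "c * expected_OPT h C \<le> (?r + \<epsilon>) * expected_OPT h C"
      using that unfolding competitive_def by (meson order_trans)
    then show "c \<le> ?r + \<epsilon>"
      using * by simp
  qed
  then show ?thesis
    using upper by blast
qed

end
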